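(* Let $s,t\ge 1$ be integers, let $q\neq -1$ be a scalar, and let $\mathscr{D}(K_{s,t})$ be the $q$-distance matrix of the complete bipartite graph $K_{s,t}$. Then $$\det(\mathscr{D}(K_{s,t}))=(-1)^{s+t-2}(q+1)^{s+t-2}\left[(q+1)^2(s-1)(t-1)-st\right].$$
   Context: $q$ is a real or complex number (the paper calls it an indeterminate). For an integer $\alpha\ge 1$ put $[\alpha]=1+q+\cdots+q^{\alpha-1}$, and $[0]=0$. For a connected graph $G$ with vertices $v_1,\dots,v_N$ and shortest-path distance $d$, the $q$-distance matrix $\mathscr{D}(G)$ is the $N\times N$ matrix whose $(i,j)$ entry is $[d(v_i,v_j)]$ (so diagonal entries are $0$). $K_{s,t}$ is the complete bipartite graph with parts of sizes $s$ and $t$. *)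

theory Defs
  imports
    "Jordan_Normal_Form.Determinant"
    "Graph_Theory.Shortest_Path"
    "Graph_Theory.Kuratowski"
begin

text \<open>
  As in the library, an undirected graph is a symmetric, loop-free digraph without parallel arcs
  (locale \<^locale>\<open>graph\<close>), and \<^term>\<open>K\<^bsub>s,t\<^esub> G\<close> says that \<^term>\<open>G\<close> is a complete bipartite graph
  with parts of sizes \<^term>\<open>s\<close> and \<^term>\<open>t\<close>.
\<close>

text \<open>
  The number of arcs of a shortest walk. It is only meaningful if \<^term>\<open>v\<close> is reachable from
  \<^term>\<open>u\<close>, in particular for any two vertices of a connected graph; it is then the library's
  shortest-path cost for unit arc weights (see the lemma below).
\<close>

definition graph_dist :: "('a, 'b) pre_digraph \<Rightarrow> 'a \<Rightarrow> 'a \<Rightarrow> nat" where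
  "graph_dist G u v = (LEAST k. \<exists>p. pre_digraph.awalk G u p v \<and> length p = k)"

lemma (in wf_digraph) shortest_path_unit_eq_graph_dist:
  assumes "u \<rightarrow>\<^sup>* v"
  shows "\<mu> (\<lambda>_. 1) u v = ereal (real (graph_dist G u v))"
proof -
  have cost: "awalk_cost (\<lambda>_. 1) p = real (length p)" for p
    by (induction p) (auto simp: awalk_cost_def)
  let ?P = "\<lambda>k. \<exists>p. awalk u p v \<and> length p = k"
  have "\<exists>k. ?P k"
    using assms by (auto simp: reachable_awalk)
  then obtain p where p: "awalk u p v" "length p = graph_dist G u v"
    unfolding graph_dist_def using LeastI_ex[of ?P] by blast
  have le: "graph_dist G u v \<le> length p'" if "awalk u p' v" for p'
    unfolding graph_dist_def using that by (intro Least_le) blast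
  show ?thesis
    unfolding \<mu>_def cost
    by (rule INF_eqI) (use p le in \<open>force+\<close>)
qed

definition q_int :: "'c :: comm_ring_1 \<Rightarrow> nat \<Rightarrow> 'c" where
  "q_int q a = (\<Sum>i<a. q ^ i)"

text \<open>The list \<^term>\<open>vs\<close> is the enumeration of the vertices by which the matrix is indexed.\<close>

definition q_distance_matrix ::
    "'c :: comm_ring_1 \<Rightarrow> ('a, 'b) pre_digraph \<Rightarrow> 'a list \<Rightarrow> 'c mat" where
  "q_distance_matrix q G vs =
     mat (length vs) (length vs) (\<lambda>(i, j). q_int q (graph_dist G (vs ! i) (vs ! j)))"

end

theory Submission
  imports Defs
begin

text \<open>
  Write \<open>p = q + 1\<close>. Two distinct vertices in the same part have distance 2 and \<open>[2] = p\<close>, so the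
  \<open>q\<close>-distance matrix is \<open>- p I + M N\<close>, where the two columns of \<open>M\<close> are the indicators \<open>1\<^sub>U\<close>,
  \<open>1\<^sub>V\<close> of the parts and the two rows of \<open>N\<close> are \<open>p 1\<^sub>U + 1\<^sub>V\<close> and \<open>1\<^sub>U + p 1\<^sub>V\<close>. The
  Weinstein-Aronszajn identity reduces the determinant to that of the \<open>2 \<times> 2\<close> matrix
  \<open>- p I + N M\<close>, and this works for every enumeration of the vertices.
\<close>

lemma det_add_mult_commute:
  fixes M N :: "'a :: idom mat"
  assumes M: "M \<in> carrier_mat n m" and N: "N \<in> carrier_mat m n"
  shows "c ^ m * det (c \<cdot>\<^sub>m 1\<^sub>m n + M * N) = c ^ n * det (c \<cdot>\<^sub>m 1\<^sub>m m + N * M)"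
proof -
  let ?X = "four_block_mat (c \<cdot>\<^sub>m 1\<^sub>m n) (- M) N (1\<^sub>m m)"
  let ?L = "four_block_mat (1\<^sub>m n) M (0\<^sub>m m n) (1\<^sub>m m)"
  let ?R = "four_block_mat (1\<^sub>m n) M (0\<^sub>m m n) (c \<cdot>\<^sub>m 1\<^sub>m m)"
  have X: "?X \<in> carrier_mat (n + m) (n + m)" and L: "?L \<in> carrier_mat (n + m) (n + m)"
    and R: "?R \<in> carrier_mat (n + m) (n + m)"
    by (rule four_block_carrier_mat; simp)+
  have "?L * ?X = four_block_mat (c \<cdot>\<^sub>m 1\<^sub>m n + M * N) (0\<^sub>m n m) N (1\<^sub>m m)"
    using M N
    by (subst mult_four_block_mat[of _ n n _ m _ m _ _ n _ m]) (auto intro!: cong_four_block_mat)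
  then have "det ?L * det ?X = det (c \<cdot>\<^sub>m 1\<^sub>m n + M * N)"
    using det_mult[OF L X] M N by (simp add: det_four_block_mat_upper_right_zero[of _ n _ m])
  moreover have "c \<cdot>\<^sub>m 1\<^sub>m n * M + - M * (c \<cdot>\<^sub>m 1\<^sub>m m) = 0\<^sub>m n m"
    using M by (simp add: mult_smult_assoc_mat[of _ n n _ m] mult_smult_distrib[of _ n m _ m])
      auto
  then have "?X * ?R = four_block_mat (c \<cdot>\<^sub>m 1\<^sub>m n) (0\<^sub>m n m) N (c \<cdot>\<^sub>m 1\<^sub>m m + N * M)"
    using M N
    by (subst mult_four_block_mat[of _ n n _ m _ m _ _ n _ m])
      (auto simp: comm_add_mat[of _ m m] intro!: cong_four_block_mat)
  then have "det ?X * det ?R = c ^ n * det (c \<cdot>\<^sub>m 1\<^sub>m m + N * M)"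
    using det_mult[OF X R] M N by (simp add: det_four_block_mat_upper_right_zero[of _ n _ m])
  moreover have "det ?L = 1" "det ?R = c ^ m"
    using M by (simp_all add: det_four_block_mat_lower_left_zero[of _ n _ m])
  ultimately show ?thesis
    by (simp add: mult.commute)
qed

lemma det_carrier_mat_2:
  fixes A :: "'a :: comm_ring_1 mat"
  assumes A: "A \<in> carrier_mat 2 2"
  shows "det A = A $$ (0, 0) * A $$ (1, 1) - A $$ (0, 1) * A $$ (1, 0)"
proof -
  \<comment> \<open>On indices below 2, \<open>1 - i\<close> swaps 0 and 1, so it names the row that
    survives the deletion.\<close>
  have "det (mat_delete A i j) = A $$ (1 - i, 1 - j)" if "i < 2" "j < 2" for i j
    using A that mat_delete_carrier[OF A, of i j]
    by (subst det_single) (auto simp: mat_delete_def less_2_cases_iff)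
  then show ?thesis
    by (subst laplace_expansion_row[OF A, of 0])
      (simp_all add: cofactor_def numeral_2_eq_2)
qed

context wf_digraph
begin

lemma graph_dist_self:
  assumes "u \<in> verts G"
  shows "graph_dist G u u = 0"
  unfolding graph_dist_def using assms by (intro Least_eq_0) (auto simp: awalk_Nil_iff)

lemma graph_dist_adj:
  assumes "u \<noteq> v" "(u, v) \<in> arcs_ends G"
  shows "graph_dist G u v = 1"
  unfolding graph_dist_def
proof (rule Least_equality)
  show "\<exists>p. awalk u p v \<and> length p = 1"
    using assms(2) by (auto simp: arcs_ends_def arc_to_ends_def dest!: arc_implies_awalk)
  show "1 \<le> k" if "\<exists>p. awalk u p v \<and> length p = k" for k
    using that assms(1) by (cases k) (auto simp: awalk_Nil_iff)
qed

text \<open>The walk through the common neighbour \<open>w\<close> gives the upper bound; a walk of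
  length 0 would force \<open>u = v\<close>, and one of length 1 would be an arc from
  \<open>u\<close> to \<open>v\<close>.\<close>

lemma graph_dist_eq_2:
  assumes "u \<noteq> v" "(u, v) \<notin> arcs_ends G" "(u, w) \<in> arcs_ends G" "(w, v) \<in> arcs_ends G"
  shows "graph_dist G u v = 2"
  unfolding graph_dist_def
proof (rule Least_equality)
  obtain e f where "e \<in> arcs G" "tail G e = u" "head G e = w"
    "f \<in> arcs G" "tail G f = w" "head G f = v"
    using assms(3,4) by (auto simp: arcs_ends_def arc_to_ends_def)
  then have "awalk u [e, f] v"
    by (auto simp: awalk_simps)
  then show "\<exists>p. awalk u p v \<and> length p = 2"
    by (intro exI[of _ "[e, f]"]) simp
  show "2 \<le> k" if "\<exists>p. awalk u p v \<and> length p = k" for k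
  proof (rule ccontr)
    assume "\<not> 2 \<le> k"
    with that obtain p where p: "awalk u p v" "length p = 0 \<or> length p = 1"
      by (auto simp: not_le less_Suc_eq numeral_2_eq_2)
    then show False
      using assms(1,2) by (auto simp: length_Suc_conv awalk_simps arcs_ends_def arc_to_ends_def)
  qed
qed

end

text \<open>Indexing into a distinct list is a bijection onto its set, so a sum over positions only
  counts members. This makes \<open>N * M\<close> independent of the order of the vertices.\<close>

lemma sum_nth_if_mem:
  assumes "distinct xs" "A \<subseteq> set xs"
  shows "(\<Sum>i = 0..<length xs. if xs ! i \<in> A then a else 0) = of_nat (card A) * (a :: 'a :: semiring_1)"
proof -
  have "(\<Sum>i = 0..<length xs. if xs ! i \<in> A then a else 0) = (\<Sum>x\<in>set xs. if x \<in> A then a else 0)"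
    using bij_betw_nth[OF assms(1) refl refl]
    by (intro sum.reindex_bij_betw) (simp add: atLeast0LessThan)
  also have "\<dots> = of_nat (card A) * a"
    using assms(2) by (simp add: sum.If_cases Int_absorb1)
  finally show ?thesis .
qed

theorem theorem3p1:
  fixes G :: "('a, 'b) pre_digraph"
    and vs :: "'a list"
    and s t :: nat
    and q :: "'c :: real_normed_field"
  assumes "s \<ge> 1" and "t \<ge> 1"
    and "q \<noteq> - 1"
    and "K\<^bsub>s,t\<^esub> G"
    and "distinct vs" and "set vs = verts G"
  shows "det (q_distance_matrix q G vs) =
    (- 1) ^ (s + t - 2) * (q + 1) ^ (s + t - 2) *
    ((q + 1)\<^sup>2 * (of_nat s - 1) * (of_nat t - 1) - of_nat s * of_nat t)"
proof -
  obtain U V where verts: "verts G = U \<union> V" and disj: "U \<inter> V = {}"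
    and card: "card U = s" "card V = t" and arcs: "arcs_ends G = U \<times> V \<union> V \<times> U"
    using assms(4) unfolding complete_bipartite_digraph_def by blast
  interpret graph G
    using assms(4) unfolding complete_bipartite_digraph_def by blast
  obtain u0 v0 where u0: "u0 \<in> U" and v0: "v0 \<in> V"
    using card assms(1,2) by fastforce
  have n: "length vs = s + t"
    using card disj assms(5,6) verts finite_verts
    by (metis card_Un_disjoint distinct_card finite_Un)
  have dist: "graph_dist G u v = (if u = v then 0 else if u \<in> U \<longleftrightarrow> v \<in> U then 2 else 1)"
    if "u \<in> verts G" "v \<in> verts G" for u v
  proof -
    have part: "u \<in> V \<longleftrightarrow> u \<notin> U" "v \<in> V \<longleftrightarrow> v \<notin> U"
      using that verts disj by auto
    show ?thesis
    proof (cases "u = v")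
      case True
      then show ?thesis
        using that graph_dist_self by simp
    next
      case ne: False
      have adj: "(x, y) \<in> arcs_ends G \<longleftrightarrow> x \<in> U \<and> y \<in> V \<or> x \<in> V \<and> y \<in> U" for x y
        unfolding arcs by simp
      show ?thesis
      proof (cases "u \<in> U \<longleftrightarrow> v \<in> U")
        case True
        \<comment> \<open>Any vertex of the opposite part is a common neighbour; both parts are
          nonempty because \<open>s\<close> and \<open>t\<close> are positive.\<close>
        define w where "w = (if u \<in> U then v0 else u0)"
        have "(u, v) \<notin> arcs_ends G" "(u, w) \<in> arcs_ends G" "(w, v) \<in> arcs_ends G"
          using True part u0 v0 unfolding adj w_def by auto
        then show ?thesis
          using ne True graph_dist_eq_2 by simp
      next
        case False
        then have "(u, v) \<in> arcs_ends G"
          using part unfolding adj by blast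
        then show ?thesis
          using ne False graph_dist_adj by simp
      qed
    qed
  qed
  define p where "p = q + 1"
  have q_int: "q_int q 0 = 0" "q_int q (Suc 0) = 1" "q_int q 2 = p"
    by (simp_all add: q_int_def p_def numeral_2_eq_2)
  define M :: "'c mat" where
    "M = mat (s + t) 2 (\<lambda>(i, j). if vs ! i \<in> (if j = 0 then U else V) then 1 else 0)"
  define N :: "'c mat" where
    "N = mat 2 (s + t) (\<lambda>(i, j). if vs ! j \<in> (if i = 0 then U else V) then p else 1)"
  have M: "M \<in> carrier_mat (s + t) 2" and N: "N \<in> carrier_mat 2 (s + t)"
    by (simp_all add: M_def N_def)
  have vs: "vs ! i \<in> verts G" "vs ! i \<in> V \<longleftrightarrow> vs ! i \<notin> U" if "i < s + t" for i
    using that n assms(6) verts disj nth_mem[of i vs] by auto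
  \<comment> \<open>Row \<open>i\<close> of \<open>M\<close> has a single 1, in the column of the
    part containing \<open>vs ! i\<close>, and so selects the row of \<open>N\<close> for that
    part.\<close>
  have MN: "(M * N) $$ (i, j) = (if vs ! i \<in> U \<longleftrightarrow> vs ! j \<in> U then p else 1)"
    if "i < s + t" "j < s + t" for i j
  proof -
    have "(M * N) $$ (i, j) = M $$ (i, 0) * N $$ (0, j) + M $$ (i, 1) * N $$ (1, j)"
      using that M N by (simp add: scalar_prod_def sum.atLeast0_lessThan_Suc numeral_2_eq_2)
    then show ?thesis
      using that vs by (simp add: M_def N_def)
  qed
  \<comment> \<open>Off the diagonal \<open>M * N\<close> already has the right entries. On the
    diagonal it has \<open>p\<close> instead of 0, which the scalar matrix corrects; distinctness of
    \<open>vs\<close> ensures that equal vertices occur only there.\<close>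
  have D: "q_distance_matrix q G vs = (- p) \<cdot>\<^sub>m 1\<^sub>m (s + t) + M * N"
  proof (rule eq_matI)
    fix i j
    assume "i < dim_row ((- p) \<cdot>\<^sub>m 1\<^sub>m (s + t) + M * N)"
      and "j < dim_col ((- p) \<cdot>\<^sub>m 1\<^sub>m (s + t) + M * N)"
    then have ij: "i < s + t" "j < s + t"
      using M N by simp_all
    then show "q_distance_matrix q G vs $$ (i, j) = ((- p) \<cdot>\<^sub>m 1\<^sub>m (s + t) + M * N) $$ (i, j)"
      using M N vs n assms(5)
      by (simp add: q_distance_matrix_def MN dist q_int nth_eq_iff_index_eq del: index_mult_mat(1))
  qed (use M N n in \<open>simp_all add: q_distance_matrix_def\<close>)
  \<comment> \<open>Column \<open>j\<close> of \<open>M\<close> restricts the sum to one part, on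
    which row \<open>i\<close> of \<open>N\<close> is constant. Hence \<open>N * M\<close> has rows
    \<open>(p s, t)\<close> and \<open>(s, p t)\<close>.\<close>
  have NM: "(N * M) $$ (i, j) = of_nat (card (if j = 0 then U else V)) * (if i = j then p else 1)"
    if "i < 2" "j < 2" for i j
  proof -
    let ?A = "if j = 0 then U else V"
    have "(N * M) $$ (i, j) =
      (\<Sum>k = 0..<length vs. if vs ! k \<in> ?A then (if i = j then p else 1) else 0)"
      using that vs n by (auto simp: M_def N_def scalar_prod_def less_2_cases_iff intro!: sum.cong)
    also have "\<dots> = of_nat (card ?A) * (if i = j then p else 1)"
      using assms(5,6) verts by (intro sum_nth_if_mem) auto
    finally show ?thesis .
  qed
  have "det ((- p) \<cdot>\<^sub>m 1\<^sub>m 2 + N * M) = p\<^sup>2 * (of_nat s - 1) * (of_nat t - 1) - of_nat s * of_nat t"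
    using M N
    by (subst det_carrier_mat_2)
      (auto simp: NM card algebra_simps power2_eq_square simp del: index_mult_mat(1))
  then have "(- p)\<^sup>2 * det (q_distance_matrix q G vs) =
      (- p) ^ (s + t) * (p\<^sup>2 * (of_nat s - 1) * (of_nat t - 1) - of_nat s * of_nat t)"
    using det_add_mult_commute[OF M N, of "- p"] D by simp
  \<comment> \<open>Since \<open>s + t\<close> is at least 2, the subtraction in the exponent is not
    truncated. The factor split off matches the one on the left of the previous equation, and it
    cancels because \<open>q \<noteq> - 1\<close> makes \<open>p\<close> nonzero.\<close>
  moreover have "(- p) ^ (s + t) = (- p)\<^sup>2 * (- p) ^ (s + t - 2)"
    by (metis assms(1,2) add_mono le_add_diff_inverse one_add_one power_add)
  moreover have "p \<noteq> 0"
    using assms(3) unfolding p_def eq_neg_iff_add_eq_0 .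
  ultimately have "det (q_distance_matrix q G vs) =
      (- p) ^ (s + t - 2) * (p\<^sup>2 * (of_nat s - 1) * (of_nat t - 1) - of_nat s * of_nat t)"
    by simp
  then show ?thesis
    by (simp only: p_def power_minus[of "q + 1" "s + t - 2"])
qed

end
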